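(* Let $G$ be a finitely generated infinite amenable group. Then $\dim_{\mathbb{R}}\widehat{H}_0^{\mathrm{uf}}(G;\mathbb{R})=\infty$, where $\widehat{H}_0^{\mathrm{uf}}(G;\mathbb{R})\subseteq H_0^{\mathrm{uf}}(G;\mathbb{R})$ is the mean-invisible part of uniformly finite homology in degree $0$.
   Context: Groups are discrete. $\ell^\infty(G)$ is the space of bounded functions $G\to\mathbb{R}$ with left action $(g\cdot\varphi)(g')=\varphi(g^{-1}g')$. $M(G)$ is the set of left $G$-invariant means, i.e. linear maps $m\colon\ell^\infty(G)\to\mathbb{R}$ with $m(\chi_G)=1$, with $m(\varphi)\ge 0$ whenever $\varphi\geq 0$, and with $m(g\cdot\varphi)=m(\varphi)$ for all $g\in G$, $\varphi\in\ell^\infty(G)$. $G$ is amenable if $M(G)\neq\emptyset$. Uniformly finite homology. Equip the finitely generated group $G$ with the word metric $d(g,h)=\min\{k: g^{-1}h=s_1\cdots s_k,\ s_i\in S\cup S^{-1}\}$ for a finite generating set $S$. $C_n^{\mathrm{uf}}(G;\mathbb{R})$ is the real vector space of bounded functions $c\colon G^{n+1}\to\mathbb{R}$ for which there is $R_c>0$ such that $c(x_0,\dots,x_n)=0$ whenever $\sup_{i,j}d(x_i,x_j)>R_c$. Writing $c$ as a formal sum $\sum_x c(x)\cdot x$, the boundary operator is given by $\partial_n(x_0,\dots,x_n)=\sum_{j=0}^n(-1)^j(x_0,\dots,\widehat{x_j},\dots,x_n)$, extended to (infinite) formal sums. $H_*^{\mathrm{uf}}(G;\mathbb{R})$ is the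 homology of this complex; it does not depend on $S$ up to canonical isomorphism. In particular $C_0^{\mathrm{uf}}(G;\mathbb{R})=\ell^\infty(G)$. For $m\in M(G)$ let $\overline{m}_0\colon C_0^{\mathrm{uf}}(G;\mathbb{R})\to\mathbb{R}$ be $\overline{m}_0(c)=m(g\mapsto c(g^{-1}))$; this is a right-invariant mean and induces a well-defined linear map $\overline{m}_0\colon H_0^{\mathrm{uf}}(G;\mathbb{R})\to\mathbb{R}$. The mean-invisible part is the subspace $\widehat{H}_0^{\mathrm{uf}}(G;\mathbb{R})=\{c\in H_0^{\mathrm{uf}}(G;\mathbb{R}) : \overline{m}_0(c)=0\text{ for all } m\in M(G)\}$. *)

theory Defs
  imports "Jordan_Normal_Form.VS_Connect" "HOL-Algebra.AbelCoset" "HOL-Algebra.Generated_Groups"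
begin

text \<open>Functions on the group, and chains, are total HOL functions normalised to be \<open>0\<close> outside
  the carrier (resp. outside the tuples over the carrier), so that equality of functions is
  equality on the carrier and the vector space operations are pointwise.\<close>

definition linf :: "('a, 'b) monoid_scheme \<Rightarrow> ('a \<Rightarrow> real) set"
  where "linf G = {\<phi>. (\<exists>B. \<forall>g\<in>carrier G. \<bar>\<phi> g\<bar> \<le> B) \<and> (\<forall>g. g \<notin> carrier G \<longrightarrow> \<phi> g = 0)}"

definition left_translate :: "('a, 'b) monoid_scheme \<Rightarrow> 'a \<Rightarrow> ('a \<Rightarrow> real) \<Rightarrow> 'a \<Rightarrow> real"
  where "left_translate G g \<phi> =
    (\<lambda>h. if h \<in> carrier G then \<phi> (inv\<^bsub>G\<^esub> g \<otimes>\<^bsub>G\<^esub> h) else 0)"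

text \<open>The left-invariant means \<open>M(G)\<close>. Only the values of \<open>m\<close> on \<^term>\<open>linf G\<close> are ever used.\<close>

definition means :: "('a, 'b) monoid_scheme \<Rightarrow> (('a \<Rightarrow> real) \<Rightarrow> real) set"
  where "means G = {m.
    (\<forall>\<phi>\<in>linf G. \<forall>\<psi>\<in>linf G. m (\<lambda>g. \<phi> g + \<psi> g) = m \<phi> + m \<psi>) \<and>
    (\<forall>a. \<forall>\<phi>\<in>linf G. m (\<lambda>g. a * \<phi> g) = a * m \<phi>) \<and>
    m (\<lambda>g. if g \<in> carrier G then 1 else 0) = 1 \<and>
    (\<forall>\<phi>\<in>linf G. (\<forall>g\<in>carrier G. 0 \<le> \<phi> g) \<longrightarrow> 0 \<le> m \<phi>) \<and>
    (\<forall>g\<in>carrier G. \<forall>\<phi>\<in>linf G. m (left_translate G g \<phi>) = m \<phi>)}"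

definition amenable :: "('a, 'b) monoid_scheme \<Rightarrow> bool"
  where "amenable G \<longleftrightarrow> means G \<noteq> {}"

definition word_dist :: "('a, 'b) monoid_scheme \<Rightarrow> 'a set \<Rightarrow> 'a \<Rightarrow> 'a \<Rightarrow> nat"
  where "word_dist G S g h =
    (LEAST k. \<exists>ss. length ss = k \<and> set ss \<subseteq> S \<union> m_inv G ` S \<and>
       foldr (\<otimes>\<^bsub>G\<^esub>) ss \<one>\<^bsub>G\<^esub> = inv\<^bsub>G\<^esub> g \<otimes>\<^bsub>G\<^esub> h)"

text \<open>A tuple \<open>(x\<^sub>0, \<dots>, x\<^sub>n)\<close> is a list of length \<open>n + 1\<close>; in particular a \<open>0\<close>-chain \<open>c\<close> has the
  coefficient \<open>c [g]\<close> at \<open>g\<close>.\<close>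

definition tuples :: "('a, 'b) monoid_scheme \<Rightarrow> nat \<Rightarrow> 'a list set"
  where "tuples G n = {x. length x = Suc n \<and> set x \<subseteq> carrier G}"

definition uf_chains :: "('a, 'b) monoid_scheme \<Rightarrow> 'a set \<Rightarrow> nat \<Rightarrow> ('a list \<Rightarrow> real) set"
  where "uf_chains G S n = {c.
    (\<exists>B. \<forall>x\<in>tuples G n. \<bar>c x\<bar> \<le> B) \<and>
    (\<forall>x. x \<notin> tuples G n \<longrightarrow> c x = 0) \<and>
    (\<exists>R>0::real. \<forall>x\<in>tuples G n.
       real (SUP (g, h)\<in>set x \<times> set x. word_dist G S g h) > R \<longrightarrow> c x = 0)}"

definition face :: "nat \<Rightarrow> 'a list \<Rightarrow> 'a list"
  where "face j x = take j x @ drop (Suc j) x"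

text \<open>The coefficient of \<open>\<partial>\<^sub>n c\<close> at \<open>y\<close>, for \<open>n \<ge> 1\<close>: the contributions of the tuples \<open>x\<close> with \<open>j\<close>-th
  face \<open>y\<close> are collected. Only finitely many of these lie in the support of a uniformly finite
  chain \<open>c\<close>, and the inner sum is restricted to them.\<close>

definition uf_boundary :: "nat \<Rightarrow> ('a list \<Rightarrow> real) \<Rightarrow> 'a list \<Rightarrow> real"
  where "uf_boundary n c = (\<lambda>y. \<Sum>j\<le>n. (-1) ^ j * (\<Sum>x | face j x = y \<and> c x \<noteq> 0. c x))"

definition uf_cycles :: "('a, 'b) monoid_scheme \<Rightarrow> 'a set \<Rightarrow> nat \<Rightarrow> ('a list \<Rightarrow> real) set"
  where "uf_cycles G S n =
    (if n = 0 then uf_chains G S 0 else {c \<in> uf_chains G S n. uf_boundary n c = (\<lambda>_. 0)})"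

definition uf_boundaries :: "('a, 'b) monoid_scheme \<Rightarrow> 'a set \<Rightarrow> nat \<Rightarrow> ('a list \<Rightarrow> real) set"
  where "uf_boundaries G S n = uf_boundary (Suc n) ` uf_chains G S (Suc n)"

text \<open>The fields \<open>mult\<close> and \<open>one\<close> that the module record inherits from the ring record play no role
  in the following two real vector spaces.\<close>

definition uf_cycle_space ::
    "('a, 'b) monoid_scheme \<Rightarrow> 'a set \<Rightarrow> nat \<Rightarrow> (real, 'a list \<Rightarrow> real) module"
  where "uf_cycle_space G S n =
    \<lparr>carrier = uf_cycles G S n, mult = (\<lambda>_ _ _. 0), one = (\<lambda>_. 0),
     zero = (\<lambda>_. 0), add = (\<lambda>c d x. c x + d x), smult = (\<lambda>a c x. a * c x)\<rparr>"

text \<open>\<open>H\<^sub>n\<^sup>u\<^sup>f(G; \<real>)\<close> is the quotient of the cycles by the boundaries, with cosets as elements.\<close>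

definition uf_homology ::
    "('a, 'b) monoid_scheme \<Rightarrow> 'a set \<Rightarrow> nat \<Rightarrow> (real, ('a list \<Rightarrow> real) set) module"
  where "uf_homology G S n = (let Z = uf_cycle_space G S n; B = uf_boundaries G S n in
    \<lparr>carrier = a_rcosets\<^bsub>Z\<^esub> B, mult = (\<lambda>_ _. B), one = B,
     zero = B, add = set_add Z, smult = (\<lambda>a X. \<Union>c\<in>X. B +>\<^bsub>Z\<^esub> (a \<odot>\<^bsub>Z\<^esub> c))\<rparr>)"

definition mean_chain ::
    "('a, 'b) monoid_scheme \<Rightarrow> (('a \<Rightarrow> real) \<Rightarrow> real) \<Rightarrow> ('a list \<Rightarrow> real) \<Rightarrow> real"
  where "mean_chain G m c = m (\<lambda>g. if g \<in> carrier G then c [inv\<^bsub>G\<^esub> g] else 0)"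

text \<open>The map induced on homology: the common value of \<^term>\<open>mean_chain G m\<close> on the
  representatives of a class.\<close>

definition mean_homology ::
    "('a, 'b) monoid_scheme \<Rightarrow> (('a \<Rightarrow> real) \<Rightarrow> real) \<Rightarrow> ('a list \<Rightarrow> real) set \<Rightarrow> real"
  where "mean_homology G m X = the_elem (mean_chain G m ` X)"

definition mean_invisible :: "('a, 'b) monoid_scheme \<Rightarrow> 'a set \<Rightarrow> ('a list \<Rightarrow> real) set set"
  where "mean_invisible G S =
    {X \<in> carrier (uf_homology G S 0). \<forall>m\<in>means G. mean_homology G m X = 0}"

end

theory Submission
  imports "HOL-Analysis.Path_Connected" "HOL-Analysis.Infinite_Sum" Defs
begin

text \<open>Let \<open>N\<close> be the space of bounded \<open>0\<close>-chains killed by all invariant means; it is closed under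
  uniform limits and contains every finitely supported chain, because \<open>G\<close> is infinite. Suppose \<open>N\<close>
  is spanned by the boundaries and finitely many chains. The combinations whose data (radius, sup
  norm and coefficients) are bounded by \<open>n\<close> form a set \<open>K\<^sub>n\<close> that is convex and symmetric, and by
  Tychonoff compact, hence closed, for pointwise convergence. As \<open>N\<close> is covered by the \<open>K\<^sub>n\<close>, Baire's
  argument gives \<open>n\<close> and \<open>r > 0\<close> such that \<open>K\<^sub>n\<close> contains \<open>r\<close> times the indicator of every finite set.
  By pointwise closedness \<open>K\<^sub>n\<close> contains the constant \<open>r\<close>, so every invariant mean takes the value
  \<open>r\<close> on an element of \<open>N\<close>, which contradicts amenability.\<close>

subsection \<open>Pointwise closed covers and uniform convergence\<close>

text \<open>Tychonoff's theorem: the function type carries the product topology, and the set is the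
  full product of the \<open>I x\<close>.\<close>

lemma compact_fun_box:
  fixes I :: "'i \<Rightarrow> real set"
  assumes "\<And>x. compact (I x)"
  shows "compact {f. \<forall>x. f x \<in> I x}"
proof -
  have eq: "{f. \<forall>x. f x \<in> I x} = PiE UNIV I"
    by (auto simp: PiE_def)
  have "compactin (product_topology (\<lambda>_. euclidean) UNIV) (PiE UNIV I)"
    unfolding compactin_PiE using assms by simp
  then show ?thesis
    unfolding eq by (simp add: euclidean_product_topology)
qed

lemma tendsto_fun_pointwise:
  fixes f :: "'b \<Rightarrow> 'i \<Rightarrow> real"
  assumes "\<And>x. ((\<lambda>n. f n x) \<longlongrightarrow> l x) F"
  shows "(f \<longlongrightarrow> l) F"
proof -
  have "limitin (product_topology (\<lambda>_. euclidean) UNIV) f l F"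
    unfolding limitin_componentwise using assms by simp
  then show ?thesis
    by (simp add: euclidean_product_topology)
qed

lemma compact_imp_closed_fun:
  fixes K :: "('i \<Rightarrow> real) set"
  assumes "compact K"
  shows "closed K"
proof -
  have "Hausdorff_space (product_topology (\<lambda>_::'i. euclidean :: real topology) UNIV)"
    by (simp add: Hausdorff_space_product_topology Hausdorff_space_euclidean)
  then have "Hausdorff_space (euclidean :: ('i \<Rightarrow> real) topology)"
    by (simp add: euclidean_product_topology)
  then show ?thesis
    using assms compactin_imp_closedin by fastforce
qed

text \<open>Uniform convergence implies pointwise convergence: points of \<open>K\<close> within
  1/(n+1) of \<open>h\<close>, one for each n, would converge to \<open>h\<close> in the product
  topology, where \<open>K\<close> is closed.\<close>

lemma uniform_nbhd_avoiding_closed: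
  fixes K :: "('i \<Rightarrow> real) set"
  assumes K: "closed K" and h: "h \<notin> K"
  shows "\<exists>\<delta>>0. \<forall>f. (\<forall>x. \<bar>f x - h x\<bar> \<le> \<delta>) \<longrightarrow> f \<notin> K"
proof (rule ccontr)
  assume "\<not> ?thesis"
  then have "\<exists>f. (\<forall>x. \<bar>f x - h x\<bar> \<le> inverse (real (Suc n))) \<and> f \<in> K" for n
    by (metis inverse_positive_iff_positive of_nat_0_less_iff zero_less_Suc)
  then obtain f where f: "\<And>n x. \<bar>f n x - h x\<bar> \<le> inverse (real (Suc n))" "\<And>n. f n \<in> K"
    by metis
  have "(\<lambda>n. f n x) \<longlonglongrightarrow> h x" for x
    by (rule LIM_zero_cancel, rule tendsto_0_le[OF LIMSEQ_inverse_real_of_nat, of _ 1])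
      (use f(1) in auto)
  then have "f \<longlonglongrightarrow> h"
    by (rule tendsto_fun_pointwise)
  then show False
    using K h f(2) closed_sequentially by blast
qed

text \<open>Baire's argument for the uniform distance on \<open>N\<close>. If no \<open>K n\<close>
  contains a positive multiple of \<open>F\<close>, then every ball centred in \<open>N\<close>
  contains a smaller one that misses a given \<open>K n\<close>. Nested balls avoiding
  \<open>K 0\<close>, \<open>K 1\<close>, ... in turn shrink to a point that lies in
  \<open>N\<close> by \<open>ulim\<close> and in no \<open>K n\<close>.\<close>

lemma uniform_cover_absorbs:
  fixes N F :: "('i \<Rightarrow> real) set" and K :: "nat \<Rightarrow> ('i \<Rightarrow> real) set"
  assumes cover: "N \<subseteq> (\<Union>n. K n)"
    and closed: "\<And>n. closed (K n)"
    and sym: "\<And>n f. f \<in> K n \<Longrightarrow> (\<lambda>x. - f x) \<in> K n"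
    and mid: "\<And>n f g. f \<in> K n \<Longrightarrow> g \<in> K n \<Longrightarrow> (\<lambda>x. (f x + g x) / 2) \<in> K n"
    and zero: "(\<lambda>_. 0) \<in> N"
    and shift: "\<And>g f r. g \<in> N \<Longrightarrow> f \<in> F \<Longrightarrow> (\<lambda>x. g x + r * f x) \<in> N"
    and ulim: "\<And>h. (\<And>\<epsilon>::real. \<epsilon> > 0 \<Longrightarrow> \<exists>f\<in>N. \<forall>x. \<bar>h x - f x\<bar> \<le> \<epsilon>) \<Longrightarrow> h \<in> N"
    and bounded: "\<And>f x. f \<in> F \<Longrightarrow> \<bar>f x\<bar> \<le> 1"
  shows "\<exists>n. \<exists>r>0. \<forall>f\<in>F. (\<lambda>x. r * f x) \<in> K n"
proof (rule ccontr)
  assume neg: "\<not> ?thesis"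
  have escape: "\<exists>h\<in>N. (\<forall>x. \<bar>h x - g x\<bar> \<le> \<epsilon>) \<and> h \<notin> K n" if g: "g \<in> N" and "\<epsilon> > 0" for g \<epsilon> n
  proof (cases "g \<in> K n")
    case False
    then show ?thesis
      using that by (intro bexI[of _ g]) auto
  next
    case True
    \<comment> \<open>\<open>neg\<close> is applied with r = \<epsilon>/2 because (\<epsilon>/2) f
      is the midpoint of g + \<epsilon> f and -g. As g lies in \<open>K n\<close>, the point g +
      \<epsilon> f cannot.\<close>
    from neg \<open>\<epsilon> > 0\<close> obtain f where f: "f \<in> F" "(\<lambda>x. (\<epsilon> / 2) * f x) \<notin> K n"
      by (metis half_gt_zero)
    have "(\<lambda>x. g x + \<epsilon> * f x) \<notin> K n"
    proof
      assume "(\<lambda>x. g x + \<epsilon> * f x) \<in> K n"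
      from mid[OF this sym[OF True]] f(2) show False
        by simp
    qed
    moreover have "\<bar>(g x + \<epsilon> * f x) - g x\<bar> \<le> \<epsilon>" for x
      using bounded[OF f(1), of x] \<open>\<epsilon> > 0\<close> by (simp add: abs_mult mult_left_le)
    ultimately show ?thesis
      using shift[OF g f(1), of \<epsilon>] by (intro bexI[of _ "\<lambda>x. g x + \<epsilon> * f x"]) auto
  qed
  \<comment> \<open>A pair is a closed ball (centre, radius); \<open>step n p q\<close> makes \<open>q\<close> a ball inside \<open>p\<close> that misses \<open>K n\<close>.\<close>
  define step where "step n p q \<longleftrightarrow> fst q \<in> N \<and> 0 < snd q \<and> snd q \<le> snd p / 2 \<and>
      (\<forall>x. \<bar>fst q x - fst p x\<bar> \<le> snd p / 2) \<and>
      (\<forall>f. (\<forall>x. \<bar>f x - fst q x\<bar> \<le> snd q) \<longrightarrow> f \<notin> K n)" for n and p q :: "('i \<Rightarrow> real) \<times> real"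
  have "\<exists>q. (fst q \<in> N \<and> 0 < snd q) \<and> step n p q" if p: "fst p \<in> N \<and> 0 < snd p" for n p
  proof -
    obtain h where h: "h \<in> N" "\<forall>x. \<bar>h x - fst p x\<bar> \<le> snd p / 2" "h \<notin> K n"
      using escape[of "fst p" "snd p / 2" n] p half_gt_zero[of "snd p"] by blast
    obtain \<delta> where "\<delta> > 0" "\<forall>f. (\<forall>x. \<bar>f x - h x\<bar> \<le> \<delta>) \<longrightarrow> f \<notin> K n"
      using uniform_nbhd_avoiding_closed[OF closed h(3)] by blast
    with h p show ?thesis
      by (intro exI[of _ "(h, min \<delta> (snd p / 2))"]) (auto simp: step_def)
  qed
  moreover have "\<exists>p. fst p \<in> N \<and> (0::real) < snd p"
    using zero by (intro exI[of _ "(\<lambda>_. 0, 1)"]) simp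
  ultimately obtain p where p: "\<And>n. fst (p n) \<in> N \<and> 0 < snd (p n)"
    and ps: "\<And>n. step n (p n) (p (Suc n))"
    using dependent_nat_choice[of "\<lambda>_ p. fst p \<in> N \<and> 0 < snd p" step] by metis
  define g where "g n = fst (p n)" for n
  define d where "d n = snd (p n)" for n
  have gN: "g n \<in> N" and dpos: "0 < d n" and dhalf: "d (Suc n) \<le> d n / 2"
    and gstep: "\<bar>g (Suc n) x - g n x\<bar> \<le> d n / 2"
    and avoid: "(\<And>x. \<bar>f x - g (Suc n) x\<bar> \<le> d (Suc n)) \<Longrightarrow> f \<notin> K n" for n x f
    using p ps[of n] by (auto simp: step_def g_def d_def)
  \<comment> \<open>The radii at least halve, so \<open>d n / 2\<close> is at most
    \<open>d n - d (Suc n)\<close> and the displacements of the centres telescope.\<close>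
  have gdist: "\<bar>g (n + k) x - g n x\<bar> \<le> d n - d (n + k)" for n k x
  proof (induction k)
    case (Suc k)
    then show ?case
      using gstep[of "n + k" x] dhalf[of "n + k"] unfolding add_Suc_right by linarith
  qed simp
  have gd: "\<bar>g m x - g n x\<bar> \<le> d n" if "n \<le> m" for m n x
    using gdist[of n "m - n" x] dpos[of m] that by simp
  have dbound: "d n \<le> d 0 * (1 / 2) ^ n" for n
  proof (induction n)
    case (Suc n)
    then show ?case
      using dhalf[of n] by simp
  qed simp
  have "(\<lambda>n. d 0 * (1 / 2) ^ n) \<longlonglongrightarrow> d 0 * 0"
    by (intro tendsto_intros LIMSEQ_realpow_zero) auto
  then have dlim: "d \<longlonglongrightarrow> 0"
    by (intro tendsto_0_le[of "\<lambda>n. d 0 * (1 / 2) ^ n" _ d 1])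
      (use dbound dpos in \<open>auto simp: abs_of_pos abs_mult\<close>)
  have dsmall: "\<exists>M. d M < e" if "e > 0" for e
    using order_tendstoD(2)[OF dlim that] by (auto simp: eventually_sequentially)
  have "Cauchy (\<lambda>n. g n x)" for x
    unfolding Cauchy_def dist_real_def
  proof (intro allI impI)
    fix e :: real assume "e > 0"
    then obtain M where M: "d M < e / 2"
      using dsmall[of "e / 2"] by auto
    have "\<bar>g m x - g n x\<bar> < e" if "m \<ge> M" "n \<ge> M" for m n
      using gd[OF that(1), of x] gd[OF that(2), of x] M by linarith
    then show "\<exists>M. \<forall>m\<ge>M. \<forall>n\<ge>M. \<bar>g m x - g n x\<bar> < e"
      by blast
  qed
  then obtain h where h: "\<And>x. (\<lambda>n. g n x) \<longlonglongrightarrow> h x"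
    unfolding Cauchy_convergent_iff convergent_def by metis
  have hd: "\<bar>h x - g n x\<bar> \<le> d n" for x n
    by (rule LIMSEQ_le_const2[of "\<lambda>m. \<bar>g m x - g n x\<bar>"]) (use gd in \<open>auto intro!: tendsto_intros h\<close>)
  have "h \<in> N"
  proof (rule ulim)
    fix \<epsilon> :: real assume "\<epsilon> > 0"
    then obtain M where M: "d M < \<epsilon>"
      using dsmall by blast
    have "\<bar>h x - g M x\<bar> \<le> \<epsilon>" for x
      using hd[of x M] M by linarith
    then show "\<exists>f\<in>N. \<forall>x. \<bar>h x - f x\<bar> \<le> \<epsilon>"
      using gN by blast
  qed
  \<comment> \<open>By \<open>hd\<close>, \<open>h\<close> is within \<open>d (Suc n)\<close> of
    \<open>g (Suc n)\<close>, hence in the ball chosen to miss \<open>K n\<close>.\<close>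
  moreover have "h \<notin> K n" for n
    using avoid hd by blast
  ultimately show False
    using cover by blast
qed

subsection \<open>Word balls\<close>

text \<open>For \<open>S\<close> in the carrier this is the ball of radius \<open>n\<close> about
  the identity. Words of length at most \<open>n\<close>, not exactly \<open>n\<close>, make the
  balls increase with \<open>n\<close>.\<close>

definition word_ball :: "('a, 'b) monoid_scheme \<Rightarrow> 'a set \<Rightarrow> nat \<Rightarrow> 'a set"
  where "word_ball G S n = {foldr (\<otimes>\<^bsub>G\<^esub>) ss \<one>\<^bsub>G\<^esub> | ss. length ss \<le> n \<and> set ss \<subseteq> S \<union> m_inv G ` S}"

lemma finite_word_ball:
  assumes "finite S"
  shows "finite (word_ball G S n)"
proof -
  have "word_ball G S n = (\<lambda>ss. foldr (\<otimes>\<^bsub>G\<^esub>) ss \<one>\<^bsub>G\<^esub>) ` {ss. set ss \<subseteq> S \<union> m_inv G ` S \<and> length ss \<le> n}"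
    by (auto simp: word_ball_def)
  then show ?thesis
    using assms by (simp add: finite_lists_length_le)
qed

context Group.group
begin

lemma foldr_mult_closed:
  assumes "set ss \<subseteq> carrier G"
  shows "foldr (\<otimes>) ss \<one> \<in> carrier G"
  using assms by (induction ss) auto

lemma foldr_mult_append:
  assumes "set ss \<subseteq> carrier G" "set ts \<subseteq> carrier G"
  shows "foldr (\<otimes>) (ss @ ts) \<one> = foldr (\<otimes>) ss \<one> \<otimes> foldr (\<otimes>) ts \<one>"
  using assms by (induction ss) (auto simp: foldr_mult_closed m_assoc simp del: foldr_append)

lemma word_ball_carrier:
  assumes "S \<subseteq> carrier G"
  shows "word_ball G S n \<subseteq> carrier G"
proof -
  have "set ss \<subseteq> carrier G" if "set ss \<subseteq> S \<union> m_inv G ` S" for ss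
    using that assms by auto
  then show ?thesis
    by (auto simp: word_ball_def intro: foldr_mult_closed)
qed

lemma generate_word:
  assumes S: "S \<subseteq> carrier G" and "g \<in> generate G S"
  shows "\<exists>ss. set ss \<subseteq> S \<union> m_inv G ` S \<and> foldr (\<otimes>) ss \<one> = g"
  using assms(2)
proof induction
  case one
  show ?case by (intro exI[of _ "[]"]) simp
next
  case (incl h)
  then show ?case using S by (intro exI[of _ "[h]"]) auto
next
  case (inv h)
  then show ?case using S by (intro exI[of _ "[inv h]"]) auto
next
  case (eng h1 h2)
  then obtain ss ts where "set ss \<subseteq> S \<union> m_inv G ` S" "foldr (\<otimes>) ss \<one> = h1"
    "set ts \<subseteq> S \<union> m_inv G ` S" "foldr (\<otimes>) ts \<one> = h2" by blast
  moreover from this have "set ss \<subseteq> carrier G" "set ts \<subseteq> carrier G"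
    using S by auto
  ultimately show ?case
    using foldr_mult_append[of ss ts] by (intro exI[of _ "ss @ ts"]) auto
qed

text \<open>As \<open>S\<close> generates, some word represents the quotient, so the
  \<open>LEAST\<close> in \<open>word_dist\<close> is attained and supplies a word of length at most
  \<open>n\<close>.\<close>

lemma word_ball_word_dist:
  assumes S: "S \<subseteq> carrier G" and gen: "generate G S = carrier G"
    and gh: "g \<in> carrier G" "h \<in> carrier G" and n: "word_dist G S g h \<le> n"
  shows "inv g \<otimes> h \<in> word_ball G S n"
proof -
  let ?P = "\<lambda>k. \<exists>ss. length ss = k \<and> set ss \<subseteq> S \<union> m_inv G ` S \<and> foldr (\<otimes>) ss \<one> = inv g \<otimes> h"
  have "\<exists>k. ?P k"
    using generate_word[OF S, of "inv g \<otimes> h"] gh gen by auto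
  then have "?P (word_dist G S g h)"
    unfolding word_dist_def by (rule LeastI_ex)
  with n show ?thesis
    unfolding word_ball_def mem_Collect_eq by metis
qed

lemma word_dist_refl:
  assumes "g \<in> carrier G"
  shows "word_dist G S g g = 0"
  unfolding word_dist_def by (rule Least_eq_0) (use assms in auto)

end

subsection \<open>Chains of bounded propagation\<close>

definition bounded_chains0 :: "('a, 'b) monoid_scheme \<Rightarrow> ('a list \<Rightarrow> real) set"
  where "bounded_chains0 G = {c. (\<exists>B. \<forall>x. \<bar>c x\<bar> \<le> B) \<and> (\<forall>x. x \<notin> tuples G 0 \<longrightarrow> c x = 0)}"

text \<open>For \<open>W\<close> a word ball, these are the 1-chains with propagation and sup norm
  bounded in advance. With both bounds fixed, membership is a condition on each value separately,
  which is what compactness rests on.\<close>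

definition ctrl_chains :: "('a, 'b) monoid_scheme \<Rightarrow> 'a set \<Rightarrow> real \<Rightarrow> ('a list \<Rightarrow> real) set"
  where "ctrl_chains G W B = {c. (\<forall>x. \<bar>c x\<bar> \<le> B) \<and>
    (\<forall>x. c x \<noteq> 0 \<longrightarrow> (\<exists>g\<in>carrier G. \<exists>w\<in>W. x = [g, g \<otimes>\<^bsub>G\<^esub> w]))}"

text \<open>At a vertex g, the edges ending there start at g w^-1 and the edges starting there end
  at g w. The index set \<open>W\<close> does not depend on \<open>c\<close>, unlike the support
  sums in \<open>uf_boundary\<close>, so linearity and pointwise continuity in \<open>c\<close>
  become visible.\<close>

definition ctrl_boundary :: "('a, 'b) monoid_scheme \<Rightarrow> 'a set \<Rightarrow> ('a list \<Rightarrow> real) \<Rightarrow> 'a list \<Rightarrow> real"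
  where "ctrl_boundary G W c = (\<lambda>y. if y \<in> tuples G 0 then
     (\<Sum>w\<in>W. c [hd y \<otimes>\<^bsub>G\<^esub> inv\<^bsub>G\<^esub> w, hd y] - c [hd y, hd y \<otimes>\<^bsub>G\<^esub> w]) else 0)"

lemma tuples_0: "y \<in> tuples G 0 \<longleftrightarrow> (\<exists>g\<in>carrier G. y = [g])"
  by (auto simp: tuples_def length_Suc_conv)

lemma tuples_1: "x \<in> tuples G 1 \<longleftrightarrow> (\<exists>g\<in>carrier G. \<exists>h\<in>carrier G. x = [g, h])"
  by (auto simp: tuples_def length_Suc_conv numeral_2_eq_2)

lemma uf_chainsE:
  assumes "c \<in> uf_chains G S n"
  obtains B R where "\<And>x. x \<in> tuples G n \<Longrightarrow> \<bar>c x\<bar> \<le> B" "\<And>x. x \<notin> tuples G n \<Longrightarrow> c x = 0"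
    "R > 0" "\<And>x. x \<in> tuples G n \<Longrightarrow>
      real (SUP (g, h)\<in>set x \<times> set x. word_dist G S g h) > R \<Longrightarrow> c x = 0"
proof -
  from assms obtain B R where "\<forall>x\<in>tuples G n. \<bar>c x\<bar> \<le> B" "\<forall>x. x \<notin> tuples G n \<longrightarrow> c x = 0"
    "R > 0" "\<forall>x\<in>tuples G n.
      real (SUP (g, h)\<in>set x \<times> set x. word_dist G S g h) > R \<longrightarrow> c x = 0"
    unfolding uf_chains_def mem_Collect_eq by blast
  then show thesis
    by (intro that[of B R]) blast+
qed

lemma uf_chains_add:
  assumes "b \<in> uf_chains G S n" "c \<in> uf_chains G S n"
  shows "(\<lambda>x. b x + c x) \<in> uf_chains G S n"
proof -
  let ?d = "\<lambda>x. real (SUP (g, h)\<in>set x \<times> set x. word_dist G S g h)"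
  obtain B R where
    b: "\<And>x. x \<in> tuples G n \<Longrightarrow> \<bar>b x\<bar> \<le> B" "\<And>x. x \<notin> tuples G n \<Longrightarrow> b x = 0" "R > 0"
       "\<And>x. x \<in> tuples G n \<Longrightarrow> ?d x > R \<Longrightarrow> b x = 0"
    by (rule uf_chainsE[OF assms(1)]) (rule that; blast)
  obtain C T where
    c: "\<And>x. x \<in> tuples G n \<Longrightarrow> \<bar>c x\<bar> \<le> C" "\<And>x. x \<notin> tuples G n \<Longrightarrow> c x = 0" "T > 0"
       "\<And>x. x \<in> tuples G n \<Longrightarrow> ?d x > T \<Longrightarrow> c x = 0"
    by (rule uf_chainsE[OF assms(2)]) (rule that; blast)
  show ?thesis
    unfolding uf_chains_def mem_Collect_eq
  proof (intro conjI)
    show "\<exists>B. \<forall>x\<in>tuples G n. \<bar>b x + c x\<bar> \<le> B"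
      using b(1) c(1) by (intro exI[of _ "B + C"]) (smt (verit))
    show "\<forall>x. x \<notin> tuples G n \<longrightarrow> b x + c x = 0"
      using b(2) c(2) by simp
    show "\<exists>R>0. \<forall>x\<in>tuples G n. ?d x > R \<longrightarrow> b x + c x = 0"
      using b(3,4) c(3,4) by (intro exI[of _ "max R T"]) auto
  qed
qed

lemma uf_chains_scale:
  assumes "c \<in> uf_chains G S n"
  shows "(\<lambda>x. a * c x) \<in> uf_chains G S n"
proof -
  let ?d = "\<lambda>x. real (SUP (g, h)\<in>set x \<times> set x. word_dist G S g h)"
  obtain C T where
    c: "\<And>x. x \<in> tuples G n \<Longrightarrow> \<bar>c x\<bar> \<le> C" "\<And>x. x \<notin> tuples G n \<Longrightarrow> c x = 0" "T > 0"
       "\<And>x. x \<in> tuples G n \<Longrightarrow> ?d x > T \<Longrightarrow> c x = 0"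
    by (rule uf_chainsE[OF assms]) (rule that; blast)
  show ?thesis
    unfolding uf_chains_def mem_Collect_eq
  proof (intro conjI)
    show "\<exists>B. \<forall>x\<in>tuples G n. \<bar>a * c x\<bar> \<le> B"
      using c(1) by (intro exI[of _ "\<bar>a\<bar> * C"]) (simp add: abs_mult mult_left_mono)
    show "\<forall>x. x \<notin> tuples G n \<longrightarrow> a * c x = 0"
      using c(2) by simp
    show "\<exists>R>0. \<forall>x\<in>tuples G n. ?d x > R \<longrightarrow> a * c x = 0"
      using c(3,4) by (intro exI[of _ T]) auto
  qed
qed

lemma uf_chains_zero: "(\<lambda>_. 0) \<in> uf_chains G S n"
  unfolding uf_chains_def by (auto intro: exI[of _ 0] exI[of _ 1])

section \<open>Comparison of uniformly finite chains with chains of prescribed propagation\<close>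

context Group.group
begin

text \<open>A one-point tuple has diameter 0, so the support condition is vacuous, and vanishing off
  the tuples extends the bound to all lists.\<close>

lemma uf_chains_0: "uf_chains G S 0 = bounded_chains0 G"
proof -
  have "(SUP (g, h)\<in>set x \<times> set x. word_dist G S g h) = 0" if "x \<in> tuples G 0" for x
    using that by (auto simp: tuples_0 word_dist_refl)
  moreover have "(\<exists>B. \<forall>x\<in>tuples G 0. \<bar>c x\<bar> \<le> B) \<longleftrightarrow> (\<exists>B. \<forall>x. \<bar>c x\<bar> \<le> B)"
    if "\<forall>x. x \<notin> tuples G 0 \<longrightarrow> c x = 0" for c :: "'a list \<Rightarrow> real"
  proof
    assume "\<exists>B. \<forall>x\<in>tuples G 0. \<bar>c x\<bar> \<le> B"
    then obtain B where "\<forall>x\<in>tuples G 0. \<bar>c x\<bar> \<le> B" by blast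
    then have "\<forall>x. \<bar>c x\<bar> \<le> max 0 B"
      using that by (metis abs_zero max.cobounded1 max.coboundedI2)
    then show "\<exists>B. \<forall>x. \<bar>c x\<bar> \<le> B" by blast
  qed blast
  ultimately show ?thesis
    unfolding uf_chains_def bounded_chains0_def by (auto intro: exI[of _ 1])
qed

text \<open>A single index bounds both the sup norm and the propagation. Stating this for all large
  \<open>n\<close> lets several chains share one index.\<close>

lemma uf_chain_ctrl:
  assumes S: "S \<subseteq> carrier G" and gen: "generate G S = carrier G"
    and c: "c \<in> uf_chains G S 1"
  shows "\<exists>N. \<forall>n\<ge>N. c \<in> ctrl_chains G (word_ball G S n) (real n)"
proof -
  obtain B R where
    B: "\<And>x. x \<in> tuples G 1 \<Longrightarrow> \<bar>c x\<bar> \<le> B" and out: "\<And>x. x \<notin> tuples G 1 \<Longrightarrow> c x = 0" and "R > 0" and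
    R: "\<And>x. x \<in> tuples G 1 \<Longrightarrow> real (SUP (g, h)\<in>set x \<times> set x. word_dist G S g h) > R \<Longrightarrow> c x = 0"
    by (rule uf_chainsE[OF c]) (rule that; blast)
  \<comment> \<open>A natural number above both constants; \<open>R > 0\<close> makes the truncation
    by \<open>nat\<close> harmless.\<close>
  define N where "N = nat \<lceil>max B R\<rceil>"
  have N: "B \<le> N" "R \<le> N"
    unfolding N_def using \<open>R > 0\<close> by linarith+
  have "c \<in> ctrl_chains G (word_ball G S n) (real n)" if n: "n \<ge> N" for n
    unfolding ctrl_chains_def mem_Collect_eq
  proof (intro conjI allI impI)
    fix x
    show "\<bar>c x\<bar> \<le> real n"
      using B[of x] out[of x] N n by (cases "x \<in> tuples G 1") auto
    assume "c x \<noteq> 0"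
    then have x: "x \<in> tuples G 1"
      using out by blast
    then obtain g h where gh: "g \<in> carrier G" "h \<in> carrier G" "x = [g, h]"
      unfolding tuples_1 by blast
    have "word_dist G S g h \<le> (SUP (g, h)\<in>set x \<times> set x. word_dist G S g h)"
      using cSUP_upper[of "(g, h)" "set x \<times> set x" "\<lambda>(g, h). word_dist G S g h"] gh(3)
      by (simp add: bdd_above_finite)
    moreover have "real (SUP (g, h)\<in>set x \<times> set x. word_dist G S g h) \<le> R"
      using R[OF x] \<open>c x \<noteq> 0\<close> by force
    ultimately have "word_dist G S g h \<le> n"
      using N n by linarith
    from word_ball_word_dist[OF S gen gh(1,2) this]
    show "\<exists>g\<in>carrier G. \<exists>w\<in>word_ball G S n. x = [g, g \<otimes> w]"
      using gh by (intro bexI[of _ g] bexI[of _ "inv g \<otimes> h"]) (auto simp: inv_solve_left m_assoc[symmetric])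
  qed
  then show ?thesis by blast
qed

text \<open>Face 0 deletes the first vertex, so the edges with face 0 equal to \<open>[g]\<close>
  are those ending at g; face 1 gives those starting at g. Both families are parametrised
  injectively by \<open>W\<close>, and parameters outside the support of \<open>c\<close> contribute
  0.\<close>

lemma uf_boundary_eq_ctrl_boundary:
  assumes W: "W \<subseteq> carrier G" "finite W" and c: "c \<in> ctrl_chains G W B"
  shows "uf_boundary 1 c = ctrl_boundary G W c"
proof
  fix y
  have supp: "c x \<noteq> 0 \<Longrightarrow> \<exists>g\<in>carrier G. \<exists>w\<in>W. x = [g, g \<otimes> w]" for x
    using c by (auto simp: ctrl_chains_def)
  have eq: "uf_boundary 1 c y = (\<Sum>x | face 0 x = y \<and> c x \<noteq> 0. c x) - (\<Sum>x | face 1 x = y \<and> c x \<noteq> 0. c x)"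
    by (simp add: uf_boundary_def)
  show "uf_boundary 1 c y = ctrl_boundary G W c y"
  proof (cases "y \<in> tuples G 0")
    case False
    have "c x = 0" if "face 0 x = y \<or> face 1 x = y" for x
    proof (rule ccontr)
      assume "c x \<noteq> 0"
      with supp obtain g w where "g \<in> carrier G" "w \<in> W" "x = [g, g \<otimes> w]" by blast
      with that False W show False
        by (auto simp: face_def tuples_0)
    qed
    then have "{x. face 0 x = y \<and> c x \<noteq> 0} = {}" "{x. face 1 x = y \<and> c x \<noteq> 0} = {}"
      by auto
    with False show ?thesis
      by (simp only: eq) (simp add: ctrl_boundary_def)
  next
    case True
    then obtain g where g: "g \<in> carrier G" "y = [g]"
      by (auto simp: tuples_0)
    have "(\<Sum>x | face 0 x = y \<and> c x \<noteq> 0. c x) = (\<Sum>x\<in>(\<lambda>w. [g \<otimes> inv w, g]) ` W. c x)"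
    proof (rule sum.mono_neutral_left)
      show "{x. face 0 x = y \<and> c x \<noteq> 0} \<subseteq> (\<lambda>w. [g \<otimes> inv w, g]) ` W"
      proof
        fix x assume "x \<in> {x. face 0 x = y \<and> c x \<noteq> 0}"
        then obtain h w where "h \<in> carrier G" "w \<in> W" "x = [h, h \<otimes> w]" "h \<otimes> w = g"
          using supp[of x] g by (auto simp: face_def)
        then show "x \<in> (\<lambda>w. [g \<otimes> inv w, g]) ` W"
          using W by (intro image_eqI[of _ _ w]) (auto simp: m_assoc)
      qed
    qed (use W g in \<open>auto simp: face_def\<close>)
    also have "\<dots> = (\<Sum>w\<in>W. c [g \<otimes> inv w, g])"
      using W g by (subst sum.reindex) (auto intro!: inj_onI dest: inv_equality simp: subset_iff)
    finally have 0: "(\<Sum>x | face 0 x = y \<and> c x \<noteq> 0. c x) = (\<Sum>w\<in>W. c [g \<otimes> inv w, g])" .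
    have "(\<Sum>x | face 1 x = y \<and> c x \<noteq> 0. c x) = (\<Sum>x\<in>(\<lambda>w. [g, g \<otimes> w]) ` W. c x)"
      by (rule sum.mono_neutral_left) (use W g supp in \<open>force simp: face_def\<close>)+
    also have "\<dots> = (\<Sum>w\<in>W. c [g, g \<otimes> w])"
      using W g by (subst sum.reindex) (auto intro!: inj_onI simp: subset_iff)
    finally have 1: "(\<Sum>x | face 1 x = y \<and> c x \<noteq> 0. c x) = (\<Sum>w\<in>W. c [g, g \<otimes> w])" .
    show ?thesis
      unfolding eq 0 1 using True g by (simp add: ctrl_boundary_def sum_subtractf)
  qed
qed

end

lemma ctrl_boundary_add:
  "ctrl_boundary G W (\<lambda>x. b x + c x) y = ctrl_boundary G W b y + ctrl_boundary G W c y"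
  by (simp add: ctrl_boundary_def sum.distrib[symmetric] algebra_simps)

lemma ctrl_boundary_scale:
  "ctrl_boundary G W (\<lambda>x. a * c x) y = a * ctrl_boundary G W c y"
  by (simp add: ctrl_boundary_def sum_distrib_left algebra_simps)

text \<open>The sum has \<open>card W\<close> terms, each at most \<open>2 * B\<close> in absolute
  value. For infinite \<open>W\<close> both the sum and \<open>card W\<close> default to 0.\<close>

lemma ctrl_boundary_bounded:
  assumes "c \<in> ctrl_chains G W B"
  shows "ctrl_boundary G W c \<in> bounded_chains0 G"
proof -
  have B: "\<bar>c x\<bar> \<le> B" for x
    using assms by (auto simp: ctrl_chains_def)
  then have "0 \<le> B"
    by (meson abs_ge_zero order_trans)
  have BB: "\<bar>c x - c y\<bar> \<le> 2 * B" for x y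
    using B[of x] B[of y] by linarith
  have "\<bar>ctrl_boundary G W c y\<bar> \<le> of_nat (card W) * (2 * B)" for y
    unfolding ctrl_boundary_def using \<open>0 \<le> B\<close>
    by (auto intro!: order_trans[OF sum_abs] sum_bounded_above BB)
  then have "\<exists>B. \<forall>y. \<bar>ctrl_boundary G W c y\<bar> \<le> B"
    by blast
  then show ?thesis
    by (simp add: bounded_chains0_def) (simp add: ctrl_boundary_def)
qed

subsection \<open>Invariant means\<close>

lemma linf_add: "\<phi> \<in> linf G \<Longrightarrow> \<psi> \<in> linf G \<Longrightarrow> (\<lambda>g. \<phi> g + \<psi> g) \<in> linf G"
  unfolding linf_def
proof (clarsimp, goal_cases)
  case (1 B C)
  then show ?case by (intro exI[of _ "B + C"]) (smt (verit))
qed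

lemma linf_scale: "\<phi> \<in> linf G \<Longrightarrow> (\<lambda>g. a * \<phi> g) \<in> linf G"
  unfolding linf_def
proof (clarsimp, goal_cases)
  case (1 B)
  then show ?case by (intro exI[of _ "\<bar>a\<bar> * B"]) (simp add: abs_mult mult_left_mono)
qed

lemma linf_zero: "(\<lambda>_. 0) \<in> linf G"
  by (auto simp: linf_def)

lemma linf_sum: "finite I \<Longrightarrow> (\<And>i. i \<in> I \<Longrightarrow> \<phi> i \<in> linf G) \<Longrightarrow> (\<lambda>g. \<Sum>i\<in>I. \<phi> i g) \<in> linf G"
  by (induction I rule: finite_induct) (auto intro: linf_add linf_zero)

lemma bounded_chains0_add:
  "b \<in> bounded_chains0 G \<Longrightarrow> c \<in> bounded_chains0 G \<Longrightarrow> (\<lambda>x. b x + c x) \<in> bounded_chains0 G"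
  unfolding bounded_chains0_def
proof (clarsimp, goal_cases)
  case (1 B C)
  then show ?case by (intro exI[of _ "B + C"]) (smt (verit))
qed

lemma bounded_chains0_scale:
  "c \<in> bounded_chains0 G \<Longrightarrow> (\<lambda>x. a * c x) \<in> bounded_chains0 G"
  unfolding bounded_chains0_def
proof (clarsimp, goal_cases)
  case (1 B)
  then show ?case by (intro exI[of _ "\<bar>a\<bar> * B"]) (simp add: abs_mult mult_left_mono)
qed

lemma bounded_chains0_zero: "(\<lambda>_. 0) \<in> bounded_chains0 G"
  by (auto simp: bounded_chains0_def)

definition indicator_chain :: "'a set \<Rightarrow> 'a list \<Rightarrow> real"
  where "indicator_chain F y = (if \<exists>g\<in>F. y = [g] then 1 else 0)"

lemma indicator_chain_bounded: "F \<subseteq> carrier G \<Longrightarrow> indicator_chain F \<in> bounded_chains0 G"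
  by (auto simp: bounded_chains0_def indicator_chain_def tuples_0)

locale invariant_mean = Group.group +
  fixes m :: "('a \<Rightarrow> real) \<Rightarrow> real"
  assumes mean: "m \<in> means G"
begin

lemma m_add: "\<phi> \<in> linf G \<Longrightarrow> \<psi> \<in> linf G \<Longrightarrow> m (\<lambda>g. \<phi> g + \<psi> g) = m \<phi> + m \<psi>"
  using mean by (simp add: means_def)

lemma m_scale: "\<phi> \<in> linf G \<Longrightarrow> m (\<lambda>g. a * \<phi> g) = a * m \<phi>"
  using mean by (simp add: means_def)

lemma m_one: "m (\<lambda>g. if g \<in> carrier G then 1 else 0) = 1"
  using mean by (simp add: means_def)

lemma m_nonneg: "\<phi> \<in> linf G \<Longrightarrow> (\<And>g. g \<in> carrier G \<Longrightarrow> 0 \<le> \<phi> g) \<Longrightarrow> 0 \<le> m \<phi>"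
  using mean by (simp add: means_def)

lemma m_translate: "g \<in> carrier G \<Longrightarrow> \<phi> \<in> linf G \<Longrightarrow> m (left_translate G g \<phi>) = m \<phi>"
  using mean by (simp add: means_def)

lemma m_diff: "\<phi> \<in> linf G \<Longrightarrow> \<psi> \<in> linf G \<Longrightarrow> m (\<lambda>g. \<phi> g - \<psi> g) = m \<phi> - m \<psi>"
  using m_add[of \<phi> "\<lambda>g. -1 * \<psi> g"] m_scale[of \<psi> "-1"] linf_scale[of \<psi> G "-1"] by simp

lemma m_zero: "m (\<lambda>_. 0) = 0"
  using m_scale[of "\<lambda>g. if g \<in> carrier G then 1 else 0" 0] by (auto simp: linf_def)

lemma m_sum:
  "finite I \<Longrightarrow> (\<And>i. i \<in> I \<Longrightarrow> \<phi> i \<in> linf G) \<Longrightarrow> m (\<lambda>g. \<Sum>i\<in>I. \<phi> i g) = (\<Sum>i\<in>I. m (\<phi> i))"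
  by (induction I rule: finite_induct) (auto simp: m_zero m_add linf_sum)

lemma one_linf: "(\<lambda>g. if g \<in> carrier G then 1 else 0) \<in> linf G"
  by (auto simp: linf_def)

text \<open>Positivity of \<open>m\<close> applied to the constant \<open>B\<close> on the group
  minus \<open>\<phi>\<close>, together with normalisation.\<close>

lemma m_le:
  assumes "\<phi> \<in> linf G" "\<And>g. g \<in> carrier G \<Longrightarrow> \<phi> g \<le> B"
  shows "m \<phi> \<le> B"
proof -
  let ?o = "\<lambda>g. if g \<in> carrier G then 1 else 0 :: real"
  have B: "(\<lambda>g. B * ?o g) \<in> linf G"
    by (rule linf_scale[OF one_linf])
  have "(\<lambda>g. B * ?o g - \<phi> g) \<in> linf G"
    using linf_add[OF B linf_scale[OF assms(1), of "-1"]] by simp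
  from m_nonneg[OF this] have "0 \<le> m (\<lambda>g. B * ?o g - \<phi> g)"
    using assms by auto
  also have "\<dots> = B - m \<phi>"
    using m_diff[OF B assms(1)] m_scale[OF one_linf, of B] m_one by simp
  finally show ?thesis by simp
qed

lemma m_abs_le:
  assumes "\<phi> \<in> linf G" "\<And>g. g \<in> carrier G \<Longrightarrow> \<bar>\<phi> g\<bar> \<le> B"
  shows "\<bar>m \<phi>\<bar> \<le> B"
proof -
  have "m \<phi> \<le> B"
    using assms abs_le_D1 by (intro m_le) blast+
  moreover have "m (\<lambda>g. -1 * \<phi> g) \<le> B"
    using assms(2) by (intro m_le linf_scale assms(1)) (use abs_le_D2 in auto)
  ultimately show ?thesis
    using m_scale[OF assms(1), of "-1"] by simp
qed

text \<open>By invariance all points have the same mass. An infinite group has n distinct points for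
  every n, and their total mass is at most 1, so the common mass is 0.\<close>

lemma m_finite:
  assumes inf: "infinite (carrier G)" and F: "finite F" "F \<subseteq> carrier G"
  shows "m (\<lambda>g. if g \<in> F then 1 else 0) = 0"
proof -
  let ?\<delta> = "\<lambda>u g. if g = u then 1 else 0 :: real"
  let ?\<chi> = "\<lambda>F g. if g \<in> F then 1 else 0 :: real"
  have \<delta>: "?\<delta> u \<in> linf G" if "u \<in> carrier G" for u
    using that by (auto simp: linf_def)
  have "left_translate G u (?\<delta> \<one>) = ?\<delta> u" if u: "u \<in> carrier G" for u
  proof
    fix h
    have "inv u \<otimes> h = \<one> \<longleftrightarrow> h = u" if "h \<in> carrier G"
      using inv_solve_left[OF one_closed u that] u by auto
    then show "left_translate G u (?\<delta> \<one>) h = ?\<delta> u h"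
      using u by (auto simp: left_translate_def)
  qed
  then have t: "m (?\<delta> u) = m (?\<delta> \<one>)" if "u \<in> carrier G" for u
    using m_translate[OF that \<delta>[OF one_closed]] that by simp
  have sum: "m (?\<chi> F) = card F * m (?\<delta> \<one>)" if "finite F" "F \<subseteq> carrier G" for F
  proof -
    have "?\<chi> F = (\<lambda>g. \<Sum>u\<in>F. ?\<delta> u g)"
      using that by (auto simp: fun_eq_iff)
    then have "m (?\<chi> F) = (\<Sum>u\<in>F. m (?\<delta> u))"
      using m_sum[OF that(1), of ?\<delta>] \<delta> that by auto
    also have "\<dots> = (\<Sum>u\<in>F. m (?\<delta> \<one>))"
      using that(2) by (intro sum.cong refl t) blast
    also have "\<dots> = card F * m (?\<delta> \<one>)"
      by simp
    finally show ?thesis .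
  qed
  have "real n * m (?\<delta> \<one>) \<le> 1" for n
  proof -
    obtain U where U: "finite U" "card U = n" "U \<subseteq> carrier G"
      using infinite_arbitrarily_large[OF inf] by blast
    have "m (?\<chi> U) \<le> 1"
      using U by (intro m_le) (auto simp: linf_def)
    then show ?thesis
      using sum[OF U(1,3)] U(2) by simp
  qed
  moreover have "0 \<le> m (?\<delta> \<one>)"
    by (rule m_nonneg[OF \<delta>]) auto
  ultimately have "m (?\<delta> \<one>) = 0"
    by (metis dual_order.antisym ex_less_of_nat_mult not_le)
  with sum[OF F] show ?thesis by simp
qed

section \<open>Means of chains in degree zero\<close>

abbreviation pull :: "('a list \<Rightarrow> real) \<Rightarrow> 'a \<Rightarrow> real"
  where "pull c \<equiv> \<lambda>g. if g \<in> carrier G then c [inv g] else 0"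

lemma pull_linf: "c \<in> bounded_chains0 G \<Longrightarrow> pull c \<in> linf G"
  by (auto simp: linf_def bounded_chains0_def)

lemma mean_chain_add:
  assumes "b \<in> bounded_chains0 G" "c \<in> bounded_chains0 G"
  shows "mean_chain G m (\<lambda>x. b x + c x) = mean_chain G m b + mean_chain G m c"
proof -
  have "pull (\<lambda>x. b x + c x) = (\<lambda>g. pull b g + pull c g)" by auto
  then show ?thesis
    unfolding mean_chain_def using m_add[OF pull_linf[OF assms(1)] pull_linf[OF assms(2)]] by simp
qed

lemma mean_chain_scale:
  assumes "c \<in> bounded_chains0 G"
  shows "mean_chain G m (\<lambda>x. a * c x) = a * mean_chain G m c"
proof -
  have "pull (\<lambda>x. a * c x) = (\<lambda>g. a * pull c g)" by auto
  then show ?thesis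
    unfolding mean_chain_def using m_scale[OF pull_linf[OF assms], of a] by simp
qed

lemma mean_chain_zero: "mean_chain G m (\<lambda>_. 0) = 0"
  using m_zero by (simp add: mean_chain_def)

lemma mean_chain_abs_le:
  assumes "c \<in> bounded_chains0 G" "\<And>x. \<bar>c x\<bar> \<le> B"
  shows "\<bar>mean_chain G m c\<bar> \<le> B"
  unfolding mean_chain_def using assms by (intro m_abs_le pull_linf) auto

lemma mean_chain_indicator_carrier: "mean_chain G m (indicator_chain (carrier G)) = 1"
proof -
  have "pull (indicator_chain (carrier G)) = (\<lambda>g. if g \<in> carrier G then 1 else 0)"
    by (auto simp: indicator_chain_def)
  then show ?thesis
    unfolding mean_chain_def using m_one by simp
qed

lemma mean_chain_indicator_finite:
  assumes "infinite (carrier G)" "finite F" "F \<subseteq> carrier G"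
  shows "mean_chain G m (indicator_chain F) = 0"
proof -
  have "pull (indicator_chain F) = (\<lambda>g. if g \<in> m_inv G ` F then 1 else 0)"
    using assms(3) by (force simp: indicator_chain_def image_iff)
  then show ?thesis
    unfolding mean_chain_def using m_finite[OF assms(1), of "m_inv G ` F"] assms by auto
qed

text \<open>After inversion the boundary is a finite sum, over \<open>w\<close> in \<open>W\<close>,
  of a left translate of a bounded function minus that function. Each difference has mean 0 by
  invariance.\<close>

lemma mean_chain_ctrl_boundary:
  assumes W: "finite W" "W \<subseteq> carrier G" and c: "c \<in> ctrl_chains G W B"
  shows "mean_chain G m (ctrl_boundary G W c) = 0"
proof -
  \<comment> \<open>The inversion in \<open>mean_chain\<close> turns the right translation by \<open>w\<close> into a left translation.\<close>
  define \<phi> where "\<phi> w = (\<lambda>g. if g \<in> carrier G then c [inv g, inv g \<otimes> w] else 0)" for w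
  have \<phi>: "\<phi> w \<in> linf G" for w
    using c by (auto simp: linf_def \<phi>_def ctrl_chains_def intro!: exI[of _ B])
  have tr: "left_translate G (inv w) (\<phi> w) \<in> linf G" if "w \<in> carrier G" for w
    using c that by (auto simp: linf_def \<phi>_def ctrl_chains_def left_translate_def intro!: exI[of _ B])
  have d: "(\<lambda>g. left_translate G (inv w) (\<phi> w) g - \<phi> w g) \<in> linf G" if "w \<in> carrier G" for w
    using linf_add[OF tr[OF that] linf_scale[OF \<phi>, of "-1"]] by simp
  have "pull (ctrl_boundary G W c) = (\<lambda>g. \<Sum>w\<in>W. left_translate G (inv w) (\<phi> w) g - \<phi> w g)"
  proof
    fix g
    show "pull (ctrl_boundary G W c) g = (\<Sum>w\<in>W. left_translate G (inv w) (\<phi> w) g - \<phi> w g)"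
    proof (cases "g \<in> carrier G")
      case True
      have "left_translate G (inv w) (\<phi> w) g = c [inv g \<otimes> inv w, inv g]" if "w \<in> W" for w
        using that W True by (auto simp: left_translate_def \<phi>_def inv_mult_group m_assoc subset_iff)
      then show ?thesis
        using True by (simp add: ctrl_boundary_def tuples_0 \<phi>_def)
    qed (simp add: left_translate_def \<phi>_def)
  qed
  then have "mean_chain G m (ctrl_boundary G W c) = (\<Sum>w\<in>W. m (\<lambda>g. left_translate G (inv w) (\<phi> w) g - \<phi> w g))"
    unfolding mean_chain_def using m_sum[OF W(1), of "\<lambda>w g. left_translate G (inv w) (\<phi> w) g - \<phi> w g"] d W
    by auto
  also have "\<dots> = 0"
    using W by (intro sum.neutral) (auto simp: m_diff[OF tr \<phi>] m_translate \<phi> subset_iff)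
  finally show ?thesis .
qed

end

subsection \<open>Homology in degree zero\<close>

text \<open>The set is a box: the factor is the interval from -B to B at admissible edges and the
  singleton 0 elsewhere. It is empty for negative \<open>B\<close>.\<close>

lemma compact_ctrl_chains: "compact (ctrl_chains G W B)"
proof (cases "B \<ge> 0")
  case True
  define I where "I x = (if \<exists>g\<in>carrier G. \<exists>w\<in>W. x = [g, g \<otimes>\<^bsub>G\<^esub> w] then {-B..B} else {0})" for x
  have "c \<in> ctrl_chains G W B \<longleftrightarrow> (\<forall>x. c x \<in> I x)" for c
  proof
    assume c: "c \<in> ctrl_chains G W B"
    show "\<forall>x. c x \<in> I x"
    proof
      fix x
      have "\<bar>c x\<bar> \<le> B" "c x \<noteq> 0 \<Longrightarrow> \<exists>g\<in>carrier G. \<exists>w\<in>W. x = [g, g \<otimes>\<^bsub>G\<^esub> w]"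
        using c unfolding ctrl_chains_def by blast+
      then have "c x \<in> {-B..B}" "c x \<in> {0} \<or> (\<exists>g\<in>carrier G. \<exists>w\<in>W. x = [g, g \<otimes>\<^bsub>G\<^esub> w])"
        by auto
      then show "c x \<in> I x"
        unfolding I_def by presburger
    qed
  next
    assume c: "\<forall>x. c x \<in> I x"
    have "\<bar>c x\<bar> \<le> B" for x
      using spec[OF c, of x] True by (auto simp: I_def split: if_splits)
    moreover have "\<exists>g\<in>carrier G. \<exists>w\<in>W. x = [g, g \<otimes>\<^bsub>G\<^esub> w]" if "c x \<noteq> 0" for x
      using spec[OF c, of x] that unfolding I_def by (metis singletonD)
    ultimately show "c \<in> ctrl_chains G W B"
      unfolding ctrl_chains_def by blast
  qed
  then have "ctrl_chains G W B = {c. \<forall>x. c x \<in> I x}"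
    by blast
  then show ?thesis
    by (simp add: compact_fun_box I_def)
next
  case False
  then have "ctrl_chains G W B = {}"
    unfolding ctrl_chains_def using abs_ge_zero order_trans by blast
  then show ?thesis by simp
qed

lemma uf_boundaries_0: "uf_boundaries G S 0 = uf_boundary 1 ` uf_chains G S 1"
  by (simp add: uf_boundaries_def)

definition uf_class :: "('a, 'b) monoid_scheme \<Rightarrow> 'a set \<Rightarrow> ('a list \<Rightarrow> real) \<Rightarrow> ('a list \<Rightarrow> real) set"
  where "uf_class G S c = (\<lambda>b x. b x + c x) ` uf_boundaries G S 0"

text \<open>The chains whose classes form the mean-invisible part. The Baire argument takes place
  here, since uniform limits are taken of chains and not of classes.\<close>

definition invisible_chains :: "('a, 'b) monoid_scheme \<Rightarrow> ('a list \<Rightarrow> real) set"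
  where "invisible_chains G = {c \<in> bounded_chains0 G. \<forall>m\<in>means G. mean_chain G m c = 0}"

section \<open>The space of boundaries in degree zero\<close>

locale finitely_generated_group = Group.group +
  fixes S :: "'a set"
  assumes fin: "finite S" and sub: "S \<subseteq> carrier G" and gen: "generate G S = carrier G"
begin

abbreviation W :: "nat \<Rightarrow> 'a set" where "W \<equiv> word_ball G S"
abbreviation Bd :: "('a list \<Rightarrow> real) set" where "Bd \<equiv> uf_boundaries G S 0"
abbreviation Z :: "('a list \<Rightarrow> real) set" where "Z \<equiv> bounded_chains0 G"
abbreviation Inv :: "('a list \<Rightarrow> real) set" where "Inv \<equiv> invisible_chains G"
abbreviation cls :: "('a list \<Rightarrow> real) \<Rightarrow> ('a list \<Rightarrow> real) set" where "cls \<equiv> uf_class G S"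
abbreviation H0 :: "(real, ('a list \<Rightarrow> real) set) module" where "H0 \<equiv> uf_homology G S 0"

lemma finite_W: "finite (W n)"
  using fin by (rule finite_word_ball)

lemma W_carrier: "W n \<subseteq> carrier G"
  using sub by (rule word_ball_carrier)

lemma uf_boundary_eventually_ctrl:
  assumes "c \<in> uf_chains G S 1"
  shows "\<exists>N. \<forall>n\<ge>N. c \<in> ctrl_chains G (W n) (real n) \<and> uf_boundary 1 c = ctrl_boundary G (W n) c"
  using uf_chain_ctrl[OF sub gen assms] uf_boundary_eq_ctrl_boundary[OF W_carrier finite_W] by blast

lemma Bd_ctrl:
  assumes "b \<in> Bd"
  shows "\<exists>N. \<exists>c. \<forall>n\<ge>N. c \<in> ctrl_chains G (W n) (real n) \<and> b = ctrl_boundary G (W n) c"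
  using assms uf_boundary_eventually_ctrl unfolding uf_boundaries_0 by blast

lemma Bd_Z: "b \<in> Bd \<Longrightarrow> b \<in> Z"
  using Bd_ctrl ctrl_boundary_bounded by blast

lemma Bd_mean: "b \<in> Bd \<Longrightarrow> m \<in> means G \<Longrightarrow> mean_chain G m b = 0"
  using Bd_ctrl[of b] invariant_mean.mean_chain_ctrl_boundary[OF invariant_mean.intro[OF is_group invariant_mean_axioms.intro]
    finite_W W_carrier] by blast

text \<open>The support sums in \<open>uf_boundary\<close> hide additivity. Over one word ball large
  enough for both chains and their sum, all three boundaries are given by
  \<open>ctrl_boundary\<close>, which is linear.\<close>

lemma Bd_add:
  assumes "b \<in> Bd" "c \<in> Bd"
  shows "(\<lambda>x. b x + c x) \<in> Bd"
proof -
  obtain u v where uv: "u \<in> uf_chains G S 1" "b = uf_boundary 1 u" "v \<in> uf_chains G S 1" "c = uf_boundary 1 v"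
    using assms unfolding uf_boundaries_0 by blast
  have s: "(\<lambda>x. u x + v x) \<in> uf_chains G S 1"
    using uv by (intro uf_chains_add)
  obtain n1 n2 n3 where n: "\<forall>n\<ge>n1. uf_boundary 1 u = ctrl_boundary G (W n) u"
    "\<forall>n\<ge>n2. uf_boundary 1 v = ctrl_boundary G (W n) v"
    "\<forall>n\<ge>n3. uf_boundary 1 (\<lambda>x. u x + v x) = ctrl_boundary G (W n) (\<lambda>x. u x + v x)"
    using uf_boundary_eventually_ctrl uv(1,3) s by meson
  define n where "n = max n1 (max n2 n3)"
  have eq: "uf_boundary 1 (\<lambda>x. u x + v x) = (\<lambda>x. b x + c x)"
    using n[rule_format, of n] uv unfolding n_def by (auto simp: ctrl_boundary_add fun_eq_iff)
  show ?thesis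
    using imageI[OF s, of "uf_boundary 1"] unfolding uf_boundaries_0 eq .
qed

lemma Bd_scale:
  assumes "c \<in> Bd"
  shows "(\<lambda>x. a * c x) \<in> Bd"
proof -
  obtain v where v: "v \<in> uf_chains G S 1" "c = uf_boundary 1 v"
    using assms unfolding uf_boundaries_0 by blast
  have s: "(\<lambda>x. a * v x) \<in> uf_chains G S 1"
    using v by (intro uf_chains_scale)
  obtain n2 n3 where n: "\<forall>n\<ge>n2. uf_boundary 1 v = ctrl_boundary G (W n) v"
    "\<forall>n\<ge>n3. uf_boundary 1 (\<lambda>x. a * v x) = ctrl_boundary G (W n) (\<lambda>x. a * v x)"
    using uf_boundary_eventually_ctrl v(1) s by meson
  define n where "n = max n2 n3"
  have eq: "uf_boundary 1 (\<lambda>x. a * v x) = (\<lambda>x. a * c x)"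
    using n[rule_format, of n] v unfolding n_def by (auto simp: ctrl_boundary_scale fun_eq_iff)
  show ?thesis
    using imageI[OF s, of "uf_boundary 1"] unfolding uf_boundaries_0 eq .
qed

lemma Bd_zero: "(\<lambda>_. 0) \<in> Bd"
proof -
  have eq: "uf_boundary 1 (\<lambda>_. 0) = (\<lambda>_. 0)"
    by (simp add: uf_boundary_def)
  show ?thesis
    using imageI[OF uf_chains_zero[of G S 1], of "uf_boundary 1"] unfolding uf_boundaries_0 eq .
qed

lemma Bd_diff: "b \<in> Bd \<Longrightarrow> c \<in> Bd \<Longrightarrow> (\<lambda>x. b x - c x) \<in> Bd"
  using Bd_add[of b "\<lambda>x. -1 * c x"] Bd_scale[of c "-1"] by simp

section \<open>Classes modulo boundaries and the vector space structure on homology\<close>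

lemma mem_uf_class: "d \<in> cls c \<longleftrightarrow> (\<lambda>x. d x - c x) \<in> Bd"
proof
  assume "(\<lambda>x. d x - c x) \<in> Bd"
  then show "d \<in> cls c"
    unfolding uf_class_def by (intro image_eqI[of _ _ "\<lambda>x. d x - c x"]) auto
qed (auto simp: uf_class_def)

lemma self_in_class: "c \<in> cls c"
  using Bd_zero by (simp add: mem_uf_class)

lemma uf_class_eq_iff: "cls b = cls c \<longleftrightarrow> (\<lambda>x. b x - c x) \<in> Bd"
proof
  assume "cls b = cls c"
  then show "(\<lambda>x. b x - c x) \<in> Bd"
    using self_in_class[of b] by (simp add: mem_uf_class)
next
  assume bc: "(\<lambda>x. b x - c x) \<in> Bd"
  have "(\<lambda>x. d x - b x) \<in> Bd \<longleftrightarrow> (\<lambda>x. d x - c x) \<in> Bd" for d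
  proof
    assume "(\<lambda>x. d x - b x) \<in> Bd"
    from Bd_add[OF this bc] show "(\<lambda>x. d x - c x) \<in> Bd" by simp
  next
    assume "(\<lambda>x. d x - c x) \<in> Bd"
    from Bd_diff[OF this bc] show "(\<lambda>x. d x - b x) \<in> Bd" by simp
  qed
  then show "cls b = cls c"
    by (auto simp: mem_uf_class set_eq_iff)
qed

lemma uf_class_zero: "cls (\<lambda>_. 0) = Bd"
  by (simp add: uf_class_def)

lemma coset_eq_uf_class: "Bd +>\<^bsub>uf_cycle_space G S 0\<^esub> c = cls c"
  by (auto simp: uf_class_def a_r_coset_def' uf_cycle_space_def)

lemma carrier_homology: "carrier H0 = cls ` Z"
  by (auto simp: uf_homology_def Let_def A_RCOSETS_def' coset_eq_uf_class)
    (auto simp: uf_cycle_space_def uf_cycles_def uf_chains_0)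

lemma zero_homology: "\<zero>\<^bsub>H0\<^esub> = cls (\<lambda>_. 0)"
  by (simp add: uf_homology_def Let_def uf_class_zero)

lemma add_homology: "cls b \<oplus>\<^bsub>H0\<^esub> cls c = cls (\<lambda>x. b x + c x)"
proof -
  have "cls b \<oplus>\<^bsub>H0\<^esub> cls c = (\<Union>d\<in>cls b. \<Union>e\<in>cls c. {\<lambda>x. d x + e x})"
    by (simp add: uf_homology_def Let_def set_add_def' uf_cycle_space_def)
  also have "\<dots> = cls (\<lambda>x. b x + c x)"
  proof (intro equalityI subsetI)
    fix f assume "f \<in> (\<Union>d\<in>cls b. \<Union>e\<in>cls c. {\<lambda>x. d x + e x})"
    then obtain d e where "(\<lambda>x. d x - b x) \<in> Bd" "(\<lambda>x. e x - c x) \<in> Bd" "f = (\<lambda>x. d x + e x)"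
      by (auto simp: mem_uf_class)
    then show "f \<in> cls (\<lambda>x. b x + c x)"
      using Bd_add[of "\<lambda>x. d x - b x" "\<lambda>x. e x - c x"] by (simp add: mem_uf_class algebra_simps)
  next
    fix f assume "f \<in> cls (\<lambda>x. b x + c x)"
    then have "(\<lambda>x. f x - c x) \<in> cls b"
      by (simp add: mem_uf_class algebra_simps)
    moreover have "f = (\<lambda>x. (f x - c x) + c x)"
      by simp
    ultimately show "f \<in> (\<Union>d\<in>cls b. \<Union>e\<in>cls c. {\<lambda>x. d x + e x})"
      using self_in_class[of c] by blast
  qed
  finally show ?thesis .
qed

text \<open>The definition takes a union over representatives. As boundaries are closed under
  scaling, all cosets in this union coincide.\<close>

lemma smult_homology: "a \<odot>\<^bsub>H0\<^esub> cls c = cls (\<lambda>x. a * c x)"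
proof -
  have eq: "a \<odot>\<^bsub>H0\<^esub> cls c = (\<Union>d\<in>cls c. cls (\<lambda>x. a * d x))"
    unfolding uf_homology_def Let_def module.simps coset_eq_uf_class
    by (simp add: uf_cycle_space_def)
  have "cls (\<lambda>x. a * d x) = cls (\<lambda>x. a * c x)" if "d \<in> cls c" for d
    using Bd_scale[OF that[unfolded mem_uf_class], of a] by (simp add: uf_class_eq_iff algebra_simps)
  then show ?thesis
    unfolding eq using self_in_class[of c] by blast
qed

lemma vectorspace_homology: "vectorspace (class_ring :: real ring) H0"
proof -
  have "abelian_group H0"
  proof (rule abelian_groupI, goal_cases)
    \<comment> \<open>The existence of additive inverses: the class of -c serves.\<close>
    case (6 x)
    then obtain c where c: "c \<in> Z" "x = cls c" by (auto simp: carrier_homology)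
    then show ?case
      using bounded_chains0_scale[of c G "-1"]
      by (intro bexI[of _ "cls (\<lambda>x. -1 * c x)"]) (auto simp: add_homology zero_homology carrier_homology)
  qed (auto simp: carrier_homology add_homology zero_homology bounded_chains0_zero bounded_chains0_add
      algebra_simps intro!: imageI)
  then have "module (class_ring :: real ring) H0"
    by (intro moduleI domain.axioms(1)[OF field.axioms(1)[OF class_field]])
      (auto simp: carrier_homology add_homology smult_homology bounded_chains0_scale algebra_simps
        intro!: imageI)
  then show ?thesis
    unfolding vectorspace_def using class_field by blast
qed

text \<open>Boundaries have mean 0, so \<open>mean_chain\<close> is constant on the nonempty class
  and \<open>the_elem\<close> picks that constant.\<close>

lemma mean_homology_class:
  assumes m: "m \<in> means G" and c: "c \<in> Z"
  shows "mean_homology G m (cls c) = mean_chain G m c"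
proof -
  interpret invariant_mean G m
    using m by unfold_locales
  have "mean_chain G m d = mean_chain G m c" if d: "d \<in> cls c" for d
  proof -
    obtain b where "b \<in> Bd" "d = (\<lambda>x. b x + c x)"
      using d unfolding uf_class_def by blast
    then show ?thesis
      using mean_chain_add[OF Bd_Z c] Bd_mean[OF _ m] by simp
  qed
  then have "mean_chain G m ` cls c = {mean_chain G m c}"
    using self_in_class[of c] by blast
  then show ?thesis
    by (simp add: mean_homology_def)
qed

section \<open>The mean-invisible part at chain level\<close>

lemma mean_invisible_eq: "mean_invisible G S = cls ` Inv"
  by (auto simp: mean_invisible_def invisible_chains_def carrier_homology mean_homology_class)

lemma invisible_zero: "(\<lambda>_. 0) \<in> Inv"
proof -
  have "mean_chain G m (\<lambda>_. 0) = 0" if "m \<in> means G" for m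
  proof -
    interpret invariant_mean G m
      using that by unfold_locales
    show ?thesis by (rule mean_chain_zero)
  qed
  then show ?thesis
    by (simp add: invisible_chains_def bounded_chains0_zero)
qed

lemma invisible_lin:
  assumes b: "b \<in> Inv" and c: "c \<in> Inv"
  shows "(\<lambda>x. b x + a * c x) \<in> Inv"
proof -
  have Z: "b \<in> Z" "c \<in> Z" "(\<lambda>x. a * c x) \<in> Z"
    using b c by (auto simp: invisible_chains_def bounded_chains0_scale)
  have "mean_chain G m (\<lambda>x. b x + a * c x) = 0" if "m \<in> means G" for m
  proof -
    interpret invariant_mean G m
      using that by unfold_locales
    show ?thesis
      using mean_chain_add[OF Z(1,3)] mean_chain_scale[OF Z(2), of a] b c that
      by (simp add: invisible_chains_def)
  qed
  then show ?thesis
    using bounded_chains0_add[OF Z(1,3)] by (simp add: invisible_chains_def)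
qed

lemma invisible_sum:
  assumes "finite A" "\<And>X. X \<in> A \<Longrightarrow> v X \<in> Inv"
  shows "(\<lambda>x. \<Sum>X\<in>A. a X * v X x) \<in> Inv"
  using assms
proof (induction A rule: finite_induct)
  case (insert X A)
  then show ?case
    using invisible_lin[of "\<lambda>x. \<Sum>X\<in>A. a X * v X x" "v X" "a X"] by (simp add: add.commute)
qed (simp add: invisible_zero)

text \<open>Every mean is bounded by the sup norm, so the mean of \<open>h\<close> differs from the
  mean 0 of an approximating \<open>f\<close> by at most \<epsilon>.\<close>

lemma invisible_uniform_limit:
  assumes "\<And>\<epsilon>::real. \<epsilon> > 0 \<Longrightarrow> \<exists>f\<in>Inv. \<forall>x. \<bar>h x - f x\<bar> \<le> \<epsilon>"
  shows "h \<in> Inv"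
proof -
  have "h \<in> Z"
  proof -
    obtain f where f: "f \<in> Inv" "\<And>x. \<bar>h x - f x\<bar> \<le> 1"
      using assms[of 1] by auto
    then obtain B where B: "\<And>x. \<bar>f x\<bar> \<le> B"
      by (auto simp: invisible_chains_def bounded_chains0_def)
    have "\<bar>h x\<bar> \<le> B + 1" for x
      using f(2)[of x] B[of x] by linarith
    moreover have "h x = 0" if x: "x \<notin> tuples G 0" for x
    proof (rule ccontr)
      assume "h x \<noteq> 0"
      \<comment> \<open>With this tolerance, \<open>f x = 0\<close> would force
        \<open>\<bar>h x\<bar>\<close> to be at most half of itself.\<close>
      then obtain f where "f \<in> Inv" "\<bar>h x - f x\<bar> \<le> \<bar>h x\<bar> / 2"
        using assms[of "\<bar>h x\<bar> / 2"] by auto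
      with x \<open>h x \<noteq> 0\<close> show False
        by (auto simp: invisible_chains_def bounded_chains0_def)
    qed
    ultimately show ?thesis
      by (auto simp: bounded_chains0_def)
  qed
  moreover have "mean_chain G m h = 0" if m: "m \<in> means G" for m
  proof -
    interpret invariant_mean G m
      using m by unfold_locales
    have "\<bar>mean_chain G m h\<bar> \<le> \<epsilon>" if "\<epsilon> > 0" for \<epsilon>
    proof -
      obtain f where f: "f \<in> Inv" "\<And>x. \<bar>h x - f x\<bar> \<le> \<epsilon>"
        using assms[OF \<open>\<epsilon> > 0\<close>] by auto
      then have Z: "f \<in> Z" "(\<lambda>x. h x - f x) \<in> Z" and 0: "mean_chain G m f = 0"
        using m bounded_chains0_add[OF \<open>h \<in> Z\<close> bounded_chains0_scale[of f G "-1"]]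
        by (auto simp: invisible_chains_def)
      have "mean_chain G m h = mean_chain G m (\<lambda>x. h x - f x)"
        using mean_chain_add[OF Z(2,1)] 0 by simp
      then show ?thesis
        using mean_chain_abs_le[OF Z(2) f(2)] by simp
    qed
    then show ?thesis
      by (metis abs_le_zero_iff dense_ge)
  qed
  ultimately show ?thesis
    by (simp add: invisible_chains_def)
qed

lemma indicator_invisible:
  assumes "infinite (carrier G)" "finite F" "F \<subseteq> carrier G"
  shows "indicator_chain F \<in> Inv"
proof -
  have "mean_chain G m (indicator_chain F) = 0" if "m \<in> means G" for m
  proof -
    interpret invariant_mean G m
      using that by unfold_locales
    show ?thesis by (rule mean_chain_indicator_finite[OF assms])
  qed
  then show ?thesis
    using indicator_chain_bounded[OF assms(3)] by (simp add: invisible_chains_def)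
qed

lemma subspace_invisible: "subspace (class_ring :: real ring) (mean_invisible G S) H0"
proof -
  have "submodule (class_ring :: real ring) (mean_invisible G S) H0"
  proof (rule submodule.intro)
    show "module (class_ring :: real ring) H0"
      using vectorspace_homology by (simp add: vectorspace_def)
    show "mean_invisible G S \<subseteq> carrier H0"
      by (auto simp: mean_invisible_def)
    show "\<zero>\<^bsub>H0\<^esub> \<in> mean_invisible G S"
      by (simp add: mean_invisible_eq zero_homology invisible_zero)
    show "v \<oplus>\<^bsub>H0\<^esub> w \<in> mean_invisible G S" if "v \<in> mean_invisible G S" "w \<in> mean_invisible G S" for v w
      using that invisible_lin[of _ _ 1] by (auto simp: mean_invisible_eq add_homology)
    show "a \<odot>\<^bsub>H0\<^esub> v \<in> mean_invisible G S" if "v \<in> mean_invisible G S" for a v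
      using that invisible_lin[OF invisible_zero, of _ a] by (auto simp: mean_invisible_eq smult_homology)
  qed
  then show ?thesis
    using vectorspace_homology by (simp add: subspace_def)
qed

text \<open>Translates finite dimension of the quotient into chains: one representative is chosen
  for each spanning class, and equality of classes becomes equality modulo boundaries.\<close>

lemma finite_dim_spanning_chains:
  assumes "vectorspace.fin_dim (class_ring :: real ring) (H0\<lparr>carrier := mean_invisible G S\<rparr>)"
  shows "\<exists>V. finite V \<and> V \<subseteq> Inv \<and> (\<forall>c\<in>Inv. \<exists>a. (\<lambda>x. c x - (\<Sum>v\<in>V. a v * v x)) \<in> Bd)"
proof -
  let ?I = "H0\<lparr>carrier := mean_invisible G S\<rparr>"
  have vs: "vectorspace (class_ring :: real ring) ?I"
    by (rule vectorspace.subspace_is_vs[OF vectorspace_homology subspace_invisible])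
  interpret I: vectorspace "class_ring :: real ring" ?I
    by (rule vs)
  obtain A where A: "finite A" "A \<subseteq> cls ` Inv" "I.span A = cls ` Inv"
    using assms unfolding I.fin_dim_def by (auto simp: mean_invisible_eq)
  \<comment> \<open>Injectivity of \<open>cls\<close> on \<open>V\<close> turns sums over classes
    into sums over representatives, with \<open>a (cls v)\<close> as coefficient of
    \<open>v\<close>.\<close>
  obtain V where V: "V \<subseteq> Inv" "finite V" "inj_on cls V" "cls ` V = A"
    using A(1,2) by (metis finite_imageD subset_image_inj)
  have lincomb: "I.lincomb a (cls ` U) = cls (\<lambda>x. \<Sum>v\<in>U. a (cls v) * v x)" if "U \<subseteq> V" for a U
  proof -
    have "finite U" "U \<subseteq> Inv" "inj_on cls U"
      using that V by (auto intro: finite_subset inj_on_subset)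
    then show ?thesis
    proof (induction U rule: finite_induct)
      case empty
      then show ?case
        by (simp add: I.lincomb_def zero_homology)
    next
      case (insert v U)
      have mem: "a (cls u) \<odot>\<^bsub>?I\<^esub> cls u \<in> carrier ?I" if "u \<in> insert v U" for u
        using that insert.prems invisible_lin[OF invisible_zero, of u "a (cls u)"]
        by (auto simp: smult_homology mean_invisible_eq)
      have "cls v \<notin> cls ` U"
        using insert.hyps insert.prems by auto
      then have "I.lincomb a (cls ` insert v U) = a (cls v) \<odot>\<^bsub>?I\<^esub> cls v \<oplus>\<^bsub>?I\<^esub> I.lincomb a (cls ` U)"
        unfolding I.lincomb_def image_insert using insert.hyps mem by (intro I.finsum_insert) auto
      then show ?case
        using insert by (simp add: smult_homology add_homology)
    qed
  qed
  have "\<exists>a. (\<lambda>x. c x - (\<Sum>v\<in>V. a v * v x)) \<in> Bd" if "c \<in> Inv" for c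
  proof -
    have "cls c \<in> I.span A"
      using A(3) that by simp
    then obtain a A' where a: "finite A'" "A' \<subseteq> A" "cls c = I.lincomb a A'"
      unfolding I.span_def by blast
    \<comment> \<open>The span provides a combination over some subset of \<open>A\<close>; its
      coefficients are later extended by 0 from \<open>U\<close> to all of \<open>V\<close>.\<close>
    define U where "U = {v \<in> V. cls v \<in> A'}"
    have U: "U \<subseteq> V" "A' = cls ` U"
      using a(2) V(4) by (auto simp: U_def)
    have "(\<lambda>x. c x - (\<Sum>v\<in>U. a (cls v) * v x)) \<in> Bd"
      using a(3) lincomb[OF U(1)] U(2) by (simp add: uf_class_eq_iff)
    moreover have "(\<Sum>v\<in>U. a (cls v) * v x) = (\<Sum>v\<in>V. (if v \<in> U then a (cls v) else 0) * v x)" for x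
      using U V(2) by (intro sum.mono_neutral_cong_left) auto
    ultimately show ?thesis
      by (intro exI[of _ "\<lambda>v. if v \<in> U then a (cls v) else 0"]) simp
  qed
  then show ?thesis
    using V by blast
qed

lemma infinite_dim_invisible:
  assumes inf: "infinite (carrier G)" and am: "amenable G"
  shows "\<not> vectorspace.fin_dim (class_ring :: real ring) (H0\<lparr>carrier := mean_invisible G S\<rparr>)"
proof
  assume "vectorspace.fin_dim (class_ring :: real ring) (H0\<lparr>carrier := mean_invisible G S\<rparr>)"
  then obtain V where V: "finite V" "V \<subseteq> Inv"
    and span: "\<And>c. c \<in> Inv \<Longrightarrow> \<exists>a. (\<lambda>x. c x - (\<Sum>v\<in>V. a v * v x)) \<in> Bd"
    using finite_dim_spanning_chains by blast
  \<comment> \<open>A parameter is a 1-chain together with coefficients. The coefficients are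
    functions on all chains, though only their values on \<open>V\<close> enter, so that the
    parameter set \<open>P n\<close> is a product of a compact set of chains and a compact
    box.\<close>
  define \<Phi> where "\<Phi> n p = (\<lambda>x. ctrl_boundary G (W n) (fst p) x + (\<Sum>v\<in>V. snd p v * v x))" for n p
  define P where "P n = ctrl_chains G (W n) (real n) \<times> {a :: ('a list \<Rightarrow> real) \<Rightarrow> real. \<forall>v. a v \<in> {- real n..real n}}"
    for n :: nat
  have mem_P: "(c, a) \<in> P n \<longleftrightarrow> c \<in> ctrl_chains G (W n) (real n) \<and> (\<forall>v. \<bar>a v\<bar> \<le> real n)" for c a n
  proof -
    have "x \<in> {- real n..real n} \<longleftrightarrow> \<bar>x\<bar> \<le> real n" for x
      by auto
    then show ?thesis
      unfolding P_def by simp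
  qed
  define K where "K n = \<Phi> n ` P n" for n
  have closed: "closed (K n)" for n
  proof -
    have 1: "continuous_on UNIV (\<lambda>p :: ('a list \<Rightarrow> real) \<times> (('a list \<Rightarrow> real) \<Rightarrow> real). fst p x)" for x
      by (rule continuous_on_product_then_coordinatewise[OF continuous_on_fst[OF continuous_on_id]])
    have 2: "continuous_on UNIV (\<lambda>p :: ('a list \<Rightarrow> real) \<times> (('a list \<Rightarrow> real) \<Rightarrow> real). snd p x)" for x
      by (rule continuous_on_product_then_coordinatewise[OF continuous_on_snd[OF continuous_on_id]])
    \<comment> \<open>Each value of \<open>\<Phi> n p\<close> is a finite linear combination of
      coordinates of \<open>p\<close>; hence \<open>K n\<close> is a continuous image of a compact
      set.\<close>
    have "continuous_on UNIV (\<lambda>p. \<Phi> n p y)" for y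
      unfolding \<Phi>_def ctrl_boundary_def
      by (cases "y \<in> tuples G 0") (auto intro!: continuous_intros 1 2)
    then have "continuous_on UNIV (\<Phi> n)"
      by (rule continuous_on_coordinatewise_then_product)
    moreover have "compact (P n)"
      unfolding P_def by (intro compact_Times compact_ctrl_chains compact_fun_box) auto
    ultimately have "compact (K n)"
      unfolding K_def by (meson compact_continuous_image continuous_on_subset subset_UNIV)
    then show ?thesis
      by (rule compact_imp_closed_fun)
  qed
  have lin: "\<Phi> n (\<lambda>x. s * c x + t * d x, \<lambda>v. s * a v + t * b v) x = s * \<Phi> n (c, a) x + t * \<Phi> n (d, b) x"
    for n s t c d a b x
    unfolding \<Phi>_def fst_conv snd_conv ctrl_boundary_add ctrl_boundary_scale
    by (simp add: algebra_simps sum.distrib sum_distrib_left)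
  \<comment> \<open>Symmetry and convexity in one statement: the pairs (-1, 0) and (1/2, 1/2) for
    (s, t) give the two closure properties used below.\<close>
  have K_comb: "(\<lambda>x. s * f x + t * g x) \<in> K n"
    if fg: "f \<in> K n" "g \<in> K n" and st: "\<bar>s\<bar> + \<bar>t\<bar> \<le> 1" for n f g s t
  proof -
    obtain c a d b where "(c, a) \<in> P n" "f = \<Phi> n (c, a)" "(d, b) \<in> P n" "g = \<Phi> n (d, b)"
      using fg unfolding K_def by fast
    then have c: "c \<in> ctrl_chains G (W n) (real n)" "\<And>v. \<bar>a v\<bar> \<le> real n" "f = \<Phi> n (c, a)"
      and d: "d \<in> ctrl_chains G (W n) (real n)" "\<And>v. \<bar>b v\<bar> \<le> real n" "g = \<Phi> n (d, b)"
      by (auto simp: mem_P)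
    have bound: "\<bar>s * p + t * q\<bar> \<le> real n" if "\<bar>p\<bar> \<le> real n" "\<bar>q\<bar> \<le> real n" for p q
    proof -
      have "\<bar>s * p + t * q\<bar> \<le> \<bar>s\<bar> * \<bar>p\<bar> + \<bar>t\<bar> * \<bar>q\<bar>"
        unfolding abs_mult[symmetric] by (rule abs_triangle_ineq)
      also have "\<dots> \<le> \<bar>s\<bar> * real n + \<bar>t\<bar> * real n"
        using that by (intro add_mono mult_left_mono) auto
      also have "\<dots> \<le> 1 * real n"
        unfolding distrib_right[symmetric] using st by (intro mult_right_mono) auto
      finally show ?thesis by simp
    qed
    have "(\<lambda>x. s * c x + t * d x) \<in> ctrl_chains G (W n) (real n)"
      unfolding ctrl_chains_def mem_Collect_eq
    proof (intro conjI allI impI)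
      show "\<bar>s * c x + t * d x\<bar> \<le> real n" for x
        using c(1) d(1) by (intro bound) (auto simp: ctrl_chains_def)
      fix x assume "s * c x + t * d x \<noteq> 0"
      then have "c x \<noteq> 0 \<or> d x \<noteq> 0" by auto
      then show "\<exists>g\<in>carrier G. \<exists>w\<in>W n. x = [g, g \<otimes> w]"
        using c(1) d(1) unfolding ctrl_chains_def by blast
    qed
    moreover have "\<bar>s * a v + t * b v\<bar> \<le> real n" for v
      by (rule bound[OF c(2) d(2)])
    ultimately have "(\<lambda>x. s * c x + t * d x, \<lambda>v. s * a v + t * b v) \<in> P n"
      by (simp add: mem_P)
    then have "\<Phi> n (\<lambda>x. s * c x + t * d x, \<lambda>v. s * a v + t * b v) \<in> K n"
      unfolding K_def by blast
    also have "\<Phi> n (\<lambda>x. s * c x + t * d x, \<lambda>v. s * a v + t * b v) = (\<lambda>x. s * f x + t * g x)"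
      using lin c(3) d(3) by blast
    finally show ?thesis .
  qed
  have cover: "Inv \<subseteq> (\<Union>n. K n)"
  proof
    fix c assume "c \<in> Inv"
    then obtain a where a: "(\<lambda>x. c x - (\<Sum>v\<in>V. a v * v x)) \<in> Bd"
      using span by blast
    obtain N e where e: "\<And>n. n \<ge> N \<Longrightarrow> e \<in> ctrl_chains G (W n) (real n)"
      "\<And>n. n \<ge> N \<Longrightarrow> (\<lambda>x. c x - (\<Sum>v\<in>V. a v * v x)) = ctrl_boundary G (W n) e"
      using Bd_ctrl[OF a] by blast
    define n where "n = max N (nat \<lceil>\<Sum>v\<in>V. \<bar>a v\<bar>\<rceil>)"
    \<comment> \<open>\<open>P n\<close> bounds the coefficient at every chain, while
      \<open>n\<close> was chosen from the values on \<open>V\<close> only; so \<open>a\<close> is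
      cut off outside \<open>V\<close>.\<close>
    define a' where "a' v = (if v \<in> V then a v else 0)" for v
    have "\<bar>a' v\<bar> \<le> real n" for v
    proof (cases "v \<in> V")
      case True
      have "\<bar>a v\<bar> \<le> (\<Sum>v\<in>V. \<bar>a v\<bar>)"
        using True V(1) by (intro member_le_sum) auto
      also have "\<dots> \<le> real n"
        unfolding n_def by linarith
      finally show ?thesis
        using True by (simp add: a'_def)
    qed (simp add: a'_def)
    then have "(e, a') \<in> P n"
      using e(1)[of n] by (simp add: mem_P n_def)
    moreover have "\<Phi> n (e, a') = c"
      using e(2)[of n] by (auto simp: \<Phi>_def a'_def n_def fun_eq_iff algebra_simps)
    ultimately show "c \<in> (\<Union>n. K n)"
      unfolding K_def by blast
  qed
  have mean_K: "mean_chain G m f = 0" if "f \<in> K n" "m \<in> means G" for f n m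
  proof -
    interpret invariant_mean G m
      using that(2) by unfold_locales
    obtain c a where c: "c \<in> ctrl_chains G (W n) (real n)"
      and f: "f = (\<lambda>x. ctrl_boundary G (W n) c x + (\<Sum>v\<in>V. a v * v x))"
      using \<open>f \<in> K n\<close> unfolding K_def P_def \<Phi>_def by auto
    have "(\<lambda>x. \<Sum>v\<in>V. a v * v x) \<in> Inv"
      using invisible_sum[OF V(1), of "\<lambda>v. v" a] V(2) by blast
    then show ?thesis
      using mean_chain_add[OF ctrl_boundary_bounded[OF c], of "\<lambda>x. \<Sum>v\<in>V. a v * v x"]
        mean_chain_ctrl_boundary[OF finite_W W_carrier c] that(2)
      by (simp add: f invisible_chains_def)
  qed
  \<comment> \<open>Infinitude of the group makes these indicators invisible, whereas the indicator
    of the whole group has mean 1.\<close>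
  define F where "F = indicator_chain ` {U. finite U \<and> U \<subseteq> carrier G}"
  have "\<exists>n. \<exists>r>0. \<forall>f\<in>F. (\<lambda>x. r * f x) \<in> K n"
  proof (rule uniform_cover_absorbs[OF cover closed])
    show "(\<lambda>x. - f x) \<in> K n" if "f \<in> K n" for n f
      using K_comb[OF that that, of "-1" 0] by simp
    show "(\<lambda>x. (f x + g x) / 2) \<in> K n" if "f \<in> K n" "g \<in> K n" for n f g
      using K_comb[OF that, of "1/2" "1/2"] by (simp add: add_divide_distrib)
    show "(\<lambda>x. g x + r * f x) \<in> Inv" if "g \<in> Inv" "f \<in> F" for g f r
      using that invisible_lin indicator_invisible[OF inf] by (auto simp: F_def)
    show "\<bar>f x\<bar> \<le> 1" if "f \<in> F" for f x
      using that by (auto simp: F_def indicator_chain_def)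
  qed (auto intro: invisible_zero invisible_uniform_limit)
  then obtain n r where r: "r > 0" "\<And>U. finite U \<Longrightarrow> U \<subseteq> carrier G \<Longrightarrow> (\<lambda>x. r * indicator_chain U x) \<in> K n"
    unfolding F_def by blast
  \<comment> \<open>Limits along the directed family of finite subsets avoid an enumeration of the
    group. At each \<open>x\<close> the indicators are constant once \<open>U\<close> contains the
    entries of \<open>x\<close> that lie in the group.\<close>
  let ?fil = "finite_subsets_at_top (carrier G)"
  have "((\<lambda>U x. r * indicator_chain U x) \<longlongrightarrow> (\<lambda>x. r * indicator_chain (carrier G) x)) ?fil"
  proof (rule tendsto_fun_pointwise)
    fix x :: "'a list"
    have "\<forall>\<^sub>F U in ?fil. r * indicator_chain U x = r * indicator_chain (carrier G) x"
      unfolding eventually_finite_subsets_at_top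
    proof (intro exI[of _ "set x \<inter> carrier G"] conjI allI impI)
      fix U assume "finite U \<and> set x \<inter> carrier G \<subseteq> U \<and> U \<subseteq> carrier G"
      then show "r * indicator_chain U x = r * indicator_chain (carrier G) x"
        by (auto simp: indicator_chain_def)
    qed auto
    then show "((\<lambda>U. r * indicator_chain U x) \<longlongrightarrow> r * indicator_chain (carrier G) x) ?fil"
      by (rule tendsto_eventually)
  qed
  moreover have "\<forall>\<^sub>F U in ?fil. (\<lambda>x. r * indicator_chain U x) \<in> K n"
    using r(2) by (intro eventually_finite_subsets_at_top_weakI)
  \<comment> \<open>The convergence is only pointwise, so pointwise closedness of \<open>K n\<close>
    is essential here; uniform closedness would not suffice.\<close>
  ultimately have "(\<lambda>x. r * indicator_chain (carrier G) x) \<in> K n"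
    using closed by (metis Lim_in_closed_set finite_subsets_at_top_neq_bot)
  moreover obtain m where m: "m \<in> means G"
    using am by (auto simp: amenable_def)
  moreover have "mean_chain G m (\<lambda>x. r * indicator_chain (carrier G) x) = r"
  proof -
    interpret invariant_mean G m
      using m by unfold_locales
    show ?thesis
      using mean_chain_scale[OF indicator_chain_bounded[OF subset_refl], of r] mean_chain_indicator_carrier
      by simp
  qed
  ultimately show False
    using mean_K r(1) by fastforce
qed

end

theorem theorem5p1:
  fixes G :: "('a, 'b) monoid_scheme" and S :: "'a set"
  assumes "group G" and "infinite (carrier G)" and "amenable G"
    and "finite S" and "S \<subseteq> carrier G" and "generate G S = carrier G"
  shows "subspace (class_ring :: real ring) (mean_invisible G S) (uf_homology G S 0) \<and>
    \<not> vectorspace.fin_dim (class_ring :: real ring)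
        ((uf_homology G S 0)\<lparr>carrier := mean_invisible G S\<rparr>)"
proof -
  interpret finitely_generated_group G S
    using assms by (intro finitely_generated_group.intro finitely_generated_group_axioms.intro)
  show ?thesis
    using subspace_invisible infinite_dim_invisible assms by blast
qed

end
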